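(* For all positive integers $k$ and all prime powers $p$ with $p \leq k$, $$f(k,pk) \geq p^2.$$
   Context: Let $k,N$ be positive integers and let $A,B$ be disjoint sets with $|A|=|B|=N$. For $S\subset A\cup B$ write $S_A=S\cap A$ and $S_B=S\cap B$. A family $\mathcal{S}$ of subsets of $A\cup B$ is called semiintersecting (with constants $k$ and $N$) if (i) $|S_A|=|S_B|=k$ for all $S\in\mathcal{S}$, and (ii) for all $S\neq T$ in $\mathcal{S}$, $S_A\cap T_A=\emptyset$ if and only if $S_B\cap T_B\neq\emptyset$. Define $f(k,N)$ to be the maximum of $|\mathcal{S}|$ over all semiintersecting families $\mathcal{S}$ with constants $k$ and $N$. *)

theory Defs
  imports "HOL-Number_Theory.Prime_Powers"
begin

definition semiintersecting :: "'a set \<Rightarrow> 'a set \<Rightarrow> nat \<Rightarrow> 'a set set \<Rightarrow> bool" where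
  "semiintersecting A B k F \<longleftrightarrow>
     F \<subseteq> Pow (A \<union> B) \<and>
     (\<forall>S\<in>F. card (S \<inter> A) = k \<and> card (S \<inter> B) = k) \<and>
     (\<forall>S\<in>F. \<forall>T\<in>F. S \<noteq> T \<longrightarrow>
        ((S \<inter> A) \<inter> (T \<inter> A) = {} \<longleftrightarrow> (S \<inter> B) \<inter> (T \<inter> B) \<noteq> {}))"

definition ground_sets :: "nat \<Rightarrow> 'a set \<Rightarrow> 'a set \<Rightarrow> bool" where
  "ground_sets N A B \<longleftrightarrow>
     finite A \<and> finite B \<and> A \<inter> B = {} \<and> card A = N \<and> card B = N"

text \<open>
  The maximum depends only on the sizes of the ground sets, so it is taken over all
  ground sets of natural numbers; see \<open>max_semiintersecting_eq\<close> below for arbitrary ground sets.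
\<close>

definition max_semiintersecting :: "nat \<Rightarrow> nat \<Rightarrow> nat" where
  "max_semiintersecting k N =
     Max {card F | F. \<exists>A B :: nat set. ground_sets N A B \<and> semiintersecting A B k F}"

lemma semiintersecting_card_le:
  assumes "ground_sets N A B" "semiintersecting A B k F"
  shows "finite F" "card F \<le> 2 ^ (2 * N)"
proof -
  have fin: "finite (A \<union> B)" and F: "F \<subseteq> Pow (A \<union> B)" and c: "card (A \<union> B) = 2 * N"
    using assms by (auto simp: ground_sets_def semiintersecting_def card_Un_disjoint)
  show "finite F" using F fin by (meson finite_Pow_iff finite_subset)
  show "card F \<le> 2 ^ (2 * N)"
    using card_mono[OF _ F] fin c by (simp add: card_Pow)
qed

lemma semiintersecting_image:
  assumes F: "semiintersecting A B k F" and inj: "inj_on h (A \<union> B)"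
  shows "semiintersecting (h ` A) (h ` B) k ((`) h ` F)" "card ((`) h ` F) = card F"
proof -
  have sub: "F \<subseteq> Pow (A \<union> B)" using F by (simp add: semiintersecting_def)
  have intA: "h ` S \<inter> h ` A = h ` (S \<inter> A)" and intB: "h ` S \<inter> h ` B = h ` (S \<inter> B)"
    if "S \<in> F" for S
    using that sub inj_on_image_Int[OF inj, of S A] inj_on_image_Int[OF inj, of S B]
    by (metis PowD Un_upper1 subsetD, metis PowD Un_upper2 subsetD)
  have cd: "card (h ` X) = card X" if "X \<subseteq> A \<union> B" for X
    using that inj by (meson card_image inj_on_subset)
  have int: "h ` X \<inter> h ` Y = {} \<longleftrightarrow> X \<inter> Y = {}" if "X \<subseteq> A \<union> B" "Y \<subseteq> A \<union> B" for X Y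
    using inj_on_image_Int[OF inj that] by auto
  have disj: "(h ` (S \<inter> A)) \<inter> (h ` (T \<inter> A)) = {} \<longleftrightarrow> (S \<inter> A) \<inter> (T \<inter> A) = {}"
             "(h ` (S \<inter> B)) \<inter> (h ` (T \<inter> B)) = {} \<longleftrightarrow> (S \<inter> B) \<inter> (T \<inter> B) = {}" for S T
    by (rule int; blast)+
  have cAB: "card (h ` (S \<inter> A)) = card (S \<inter> A)" "card (h ` (S \<inter> B)) = card (S \<inter> B)" for S
    by (rule cd; blast)+
  show "semiintersecting (h ` A) (h ` B) k ((`) h ` F)"
    unfolding semiintersecting_def
  proof (intro conjI ballI impI)
    show "(`) h ` F \<subseteq> Pow (h ` A \<union> h ` B)" using sub by blast
  next
    fix S assume "S \<in> (`) h ` F"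
    then obtain S' where "S' \<in> F" "S = h ` S'" by blast
    then show "card (S \<inter> h ` A) = k" "card (S \<inter> h ` B) = k"
      using F by (simp_all add: intA intB cAB semiintersecting_def)
  next
    fix S T assume "S \<in> (`) h ` F" "T \<in> (`) h ` F" "S \<noteq> T"
    then obtain S' T' where *: "S' \<in> F" "S = h ` S'" "T' \<in> F" "T = h ` T'" "S' \<noteq> T'" by blast
    then have "((S' \<inter> A) \<inter> (T' \<inter> A) = {}) = ((S' \<inter> B) \<inter> (T' \<inter> B) \<noteq> {})"
      using F unfolding semiintersecting_def by blast
    then show "((S \<inter> h ` A) \<inter> (T \<inter> h ` A) = {}) = ((S \<inter> h ` B) \<inter> (T \<inter> h ` B) \<noteq> {})"
      using * by (simp only: intA intB disj)
  qed
  have "inj_on ((`) h) F"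
    using inj_on_image_Pow[OF inj] sub by (rule inj_on_subset)
  then show "card ((`) h ` F) = card F" by (rule card_image)
qed

lemma semiintersecting_transfer:
  assumes g: "ground_sets N A B" and g': "ground_sets N A' B'"
    and F: "semiintersecting A B k F"
  shows "\<exists>F'. semiintersecting A' B' k F' \<and> card F' = card F"
proof -
  obtain h1 h2 where h: "bij_betw h1 A A'" "bij_betw h2 B B'"
    using g g' unfolding ground_sets_def by (metis finite_same_card_bij)
  define h where "h x = (if x \<in> A then h1 x else h2 x)" for x
  have "h x = h1 x" if "x \<in> A" for x using that by (simp add: h_def)
  moreover have "h x = h2 x" if "x \<in> B" for x
    using that g by (auto simp: h_def ground_sets_def)
  ultimately have im: "bij_betw h A A'" "bij_betw h B B'"
    using h by (metis bij_betw_cong)+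
  have "bij_betw h (A \<union> B) (A' \<union> B')"
    using bij_betw_combine[OF im] g' by (simp add: ground_sets_def)
  then have "inj_on h (A \<union> B)" by (rule bij_betw_imp_inj_on)
  from semiintersecting_image[OF F this] show ?thesis
    using im by (metis bij_betw_imp_surj_on)
qed

lemma max_semiintersecting_eq:
  assumes g: "ground_sets N A B"
  shows "max_semiintersecting k N = Max {card F | F. semiintersecting A B k F}"
    and "finite {card F | F. semiintersecting A B k F}"
    and "{card F | F. semiintersecting A B k F} \<noteq> {}"
proof -
  have ex: "ground_sets N {..<N} {N..<2 * N}"
    by (auto simp: ground_sets_def)
  have "{card F | F. \<exists>A B :: nat set. ground_sets N A B \<and> semiintersecting A B k F}
      = {card F | F. semiintersecting A B k F}" (is "?L = ?R")
  proof (intro equalityI subsetI)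
    fix n assume "n \<in> ?L"
    then show "n \<in> ?R" using semiintersecting_transfer[OF _ g] by (smt (verit) mem_Collect_eq)
  next
    fix n assume "n \<in> ?R"
    then show "n \<in> ?L" using semiintersecting_transfer[OF g ex] ex by (smt (verit) mem_Collect_eq)
  qed
  then show "max_semiintersecting k N = Max ?R" by (simp add: max_semiintersecting_def)
  have "?R \<subseteq> {..2 ^ (2 * N)}" using semiintersecting_card_le[OF g] by auto
  then show "finite ?R" by (rule finite_subset) simp
  have "semiintersecting A B k {}" by (simp add: semiintersecting_def)
  then show "?R \<noteq> {}" by blast
qed

end

theory Submission
  imports Defs "HOL-Algebra.Algebraic_Closure" "HOL-Number_Theory.Residues"
begin

text \<open>
  Let \<open>K\<close> be a field with \<open>p\<close> elements. In the affine plane \<open>K \<times> K\<close> any two distinct points lie on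
  exactly one common line, and the lines fall into \<open>p + 1\<close> parallel classes of \<open>p\<close> lines each:
  the vertical class and one class for every slope. Represent each of the \<open>p\<^sup>2\<close> points by the set of
  lines through it, putting the vertical lines into \<open>A\<close> and all others into \<open>B\<close>. Two distinct points
  then meet in \<open>A\<close> or in \<open>B\<close>, but not in both.

  It remains to make each side consist of \<open>k\<close> parallel classes, so that it has \<open>p k\<close> elements, \<open>k\<close> of
  them at each point. Repeating a parallel class does not change which points meet, so \<open>A\<close> takes \<open>k\<close>
  copies of the vertical class, and \<open>B\<close> takes \<open>k\<close> classes among which each of the \<open>p\<close> slopes
  occurs; this is where \<open>p \<le> k\<close> enters. The construction is carried out in
  \<open>max_semiintersecting_ge_of_planar_coordinates\<close>.

  The field is found inside the algebraic closure of the integers modulo a prime \<open>q\<close>, as the fixed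
  points of the Frobenius power \<open>a \<mapsto> a\<^sup>Q\<close> with \<open>Q = q\<^sup>n\<close>
  (\<open>primepow_obtains_finite_subfield\<close>). They are a subfield because that map is additive in
  characteristic \<open>q\<close>, and there are \<open>Q\<close> of them because they are the roots of \<open>X\<^sup>Q - X\<close>,
  which splits over the closure and has no repeated root.
\<close>

section \<open>Semiintersecting families from affine planes\<close>

text \<open>
  The equation \<open>h m x y = b\<close> says that the point \<open>(x, y)\<close> lies on the line with slope \<open>m\<close> and
  intercept \<open>b\<close>. By \<open>inj\<close>, points on a common vertical line have no other line in common; by
  \<open>join\<close>, all other pairs of points have a common line that is not vertical.
\<close>

lemma max_semiintersecting_ge_of_planar_coordinates:
  fixes K :: "'a set" and h :: "'a \<Rightarrow> 'a \<Rightarrow> 'a \<Rightarrow> 'a" and k :: nat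
  assumes "finite K" "K \<noteq> {}" "card K \<le> k"
    and closed: "\<And>m x y. m \<in> K \<Longrightarrow> x \<in> K \<Longrightarrow> y \<in> K \<Longrightarrow> h m x y \<in> K"
    and inj: "\<And>m x y y'. m \<in> K \<Longrightarrow> x \<in> K \<Longrightarrow> y \<in> K \<Longrightarrow> y' \<in> K \<Longrightarrow> h m x y = h m x y' \<Longrightarrow> y = y'"
    and join: "\<And>x x' y y'. x \<in> K \<Longrightarrow> x' \<in> K \<Longrightarrow> y \<in> K \<Longrightarrow> y' \<in> K \<Longrightarrow> x \<noteq> x' \<Longrightarrow> \<exists>m\<in>K. h m x y = h m x' y'"
  shows "(card K)\<^sup>2 \<le> max_semiintersecting k (card K * k)"
proof -
  define A B :: "(bool \<times> 'a \<times> nat) set"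
    where "A = {True} \<times> K \<times> {..<k}" and "B = {False} \<times> K \<times> {..<k}"
  have g: "ground_sets (card K * k) A B"
    using \<open>finite K\<close> by (auto simp: ground_sets_def A_def B_def card_cartesian_product)
  have "card K > 0" using assms(1,2) by (simp add: card_gt_0_iff)
  then have "k > 0" using assms(3) by linarith
  (* The slope of the i-th parallel class on the side of B; each slope must be used. *)
  obtain e where e: "e ` {..<k} = K"
  proof -
    obtain f where f: "bij_betw f {..<card K} K"
      using ex_bij_betw_nat_finite[OF \<open>finite K\<close>] by (auto simp: atLeast0LessThan)
    define e where "e i = f (if i < card K then i else 0)" for i
    have "e ` {..<k} = f ` {..<card K}"
    proof (intro equalityI subsetI)
      fix z assume "z \<in> f ` {..<card K}"
      then obtain i where "i < card K" "z = f i" by auto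
      then have "z = e i" "i < k" using assms(3) by (auto simp: e_def)
      then show "z \<in> e ` {..<k}" by blast
    qed (use \<open>card K > 0\<close> in \<open>auto simp: e_def\<close>)
    then show thesis using f that by (simp add: bij_betw_def)
  qed
  then have eK: "e i \<in> K" if "i < k" for i using that by auto
  define SA where "SA x = (\<lambda>i. (True, x, i)) ` {..<k}" for x :: 'a
  define SB where "SB x y = (\<lambda>i. (False, h (e i) x y, i)) ` {..<k}" for x y :: 'a
  define S where "S = (\<lambda>(x, y). SA x \<union> SB x y)"
  have SA: "S (x, y) \<inter> A = SA x" if "x \<in> K" for x y
    using that by (auto simp: S_def SA_def SB_def A_def)
  have SB: "S (x, y) \<inter> B = SB x y" if "x \<in> K" "y \<in> K" for x y
    using that eK closed by (auto simp: S_def SA_def SB_def B_def)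
  have meetA: "SA x \<inter> SA x' \<noteq> {} \<longleftrightarrow> x = x'" for x x'
    using \<open>k > 0\<close> by (auto simp: SA_def)
  have meetB: "SB x y \<inter> SB x' y' \<noteq> {} \<longleftrightarrow> x \<noteq> x'"
    if "x \<in> K" "y \<in> K" "x' \<in> K" "y' \<in> K" "(x, y) \<noteq> (x', y')" for x y x' y'
  proof
    assume "SB x y \<inter> SB x' y' \<noteq> {}"
    then obtain i where i: "i < k" "h (e i) x y = h (e i) x' y'" by (auto simp: SB_def)
    then show "x \<noteq> x'" using inj eK that by (metis prod.inject)
  next
    assume "x \<noteq> x'"
    then have "\<exists>m\<in>e ` {..<k}. h m x y = h m x' y'" unfolding e using join that by blast
    then obtain i where i: "i < k" "h (e i) x y = h (e i) x' y'" by auto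
    then have "(False, h (e i) x y, i) \<in> SB x y" "(False, h (e i) x' y', i) \<in> SB x' y'"
      unfolding SB_def by blast+
    then have "(False, h (e i) x y, i) \<in> SB x y \<inter> SB x' y'" using i by simp
    then show "SB x y \<inter> SB x' y' \<noteq> {}" by blast
  qed
  have injS: "inj_on S (K \<times> K)"
  proof (rule inj_onI, rule ccontr)
    fix u v assume uv: "u \<in> K \<times> K" "v \<in> K \<times> K" "S u = S v" "u \<noteq> v"
    obtain x y x' y' where *: "u = (x, y)" "v = (x', y')" by (metis surj_pair)
    have "SA x = SA x'" "SB x y = SB x' y'" using uv * SA SB by (metis SigmaE2)+
    moreover have "SA x \<noteq> {}" "SB x y \<noteq> {}" using \<open>k > 0\<close> by (auto simp: SA_def SB_def)
    ultimately show False using meetA[of x x'] meetB[of x y x' y'] uv * by auto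
  qed
  define F where "F = S ` (K \<times> K)"
  have "semiintersecting A B k F"
    unfolding semiintersecting_def
  proof (intro conjI ballI impI)
    show "F \<subseteq> Pow (A \<union> B)"
      using eK closed by (auto simp: F_def S_def SA_def SB_def A_def B_def)
  next
    fix s assume "s \<in> F"
    then obtain x y where s: "s = S (x, y)" "x \<in> K" "y \<in> K" by (auto simp: F_def)
    show "card (s \<inter> A) = k" unfolding s(1) SA[OF s(2)] SA_def by (simp add: card_image inj_on_def)
    show "card (s \<inter> B) = k" unfolding s(1) SB[OF s(2,3)] SB_def by (simp add: card_image inj_on_def)
  next
    fix s t assume "s \<in> F" "t \<in> F" "s \<noteq> t"
    then obtain x y x' y' where s: "s = S (x, y)" "x \<in> K" "y \<in> K"
      and t: "t = S (x', y')" "x' \<in> K" "y' \<in> K" by (auto simp: F_def)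
    then have "(x, y) \<noteq> (x', y')" using \<open>s \<noteq> t\<close> by auto
    then show "s \<inter> A \<inter> (t \<inter> A) = {} \<longleftrightarrow> s \<inter> B \<inter> (t \<inter> B) \<noteq> {}"
      using meetA[of x x'] meetB[of x y x' y'] s t SA SB by auto
  qed
  moreover have "card F = (card K)\<^sup>2"
    unfolding F_def card_image[OF injS] by (simp add: card_cartesian_product power2_eq_square)
  ultimately have "(card K)\<^sup>2 \<in> {card F | F. semiintersecting A B k F}"
    by (metis (mono_tags, lifting) mem_Collect_eq)
  then show ?thesis
    unfolding max_semiintersecting_eq(1)[OF g] by (rule Max_ge[OF max_semiintersecting_eq(2)[OF g]])
qed

section \<open>The Frobenius map in a commutative ring of prime characteristic\<close>

lemma (in cring) binomial_theorem:
  assumes a: "a \<in> carrier R" and b: "b \<in> carrier R"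
  shows "(a \<oplus> b) [^] (n::nat) = (\<Oplus>i\<in>{..n}. [(n choose i)] \<cdot> (a [^] i \<otimes> b [^] (n - i)))"
proof (induction n)
  case 0
  then show ?case using a b by simp
next
  case (Suc n)
  let ?t = "\<lambda>n i. [(n choose i)] \<cdot> (a [^] i \<otimes> b [^] (n - i))"
  (* Pascal's rule: u and v are the parts of the summand for Suc n that come from
     multiplying by a and by b; u only matters at successor indices. *)
  let ?u = "\<lambda>i. [(n choose (i - 1))] \<cdot> (a [^] i \<otimes> b [^] (Suc n - i))"
  let ?v = "\<lambda>i. [(n choose i)] \<cdot> (a [^] i \<otimes> b [^] (Suc n - i))"
  have aS: "(\<Oplus>i\<in>{..n}. ?t n i) \<otimes> a = (\<Oplus>i\<in>{..n}. ?u (Suc i))"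
  proof -
    have "?t n i \<otimes> a = ?u (Suc i)" for i
      using a b by (simp add: add_pow_ldistr) (simp add: m_ac)
    then show ?thesis using a b by (subst finsum_ldistr) (auto intro!: finsum_cong')
  qed
  have bS: "(\<Oplus>i\<in>{..n}. ?t n i) \<otimes> b = (\<Oplus>i\<in>{..n}. ?v i)"
  proof -
    have "?t n i \<otimes> b = ?v i" if "i \<le> n" for i
      using a b that by (simp add: add_pow_ldistr Suc_diff_le) (simp add: m_ac)
    then show ?thesis using a b by (subst finsum_ldistr) (auto intro!: finsum_cong')
  qed
  have split0: "(\<Oplus>i\<in>{..Suc n}. f i) = (\<Oplus>i\<in>{..n}. f (Suc i)) \<oplus> f 0"
    if "\<And>i. f i \<in> carrier R" for f
    using that by (intro finsum_Suc2) auto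
  have "(a \<oplus> b) [^] Suc n = (\<Oplus>i\<in>{..n}. ?t n i) \<otimes> a \<oplus> (\<Oplus>i\<in>{..n}. ?t n i) \<otimes> b"
    using a b Suc by (simp add: r_distr)
  also have "\<dots> = (\<Oplus>i\<in>{..n}. ?u (Suc i)) \<oplus> (\<Oplus>i\<in>{..Suc n}. ?v i)"
    using a b unfolding aS bS by (subst finsum_Suc) (auto simp: binomial_eq_0)
  also have "\<dots> = (\<Oplus>i\<in>{..n}. ?u (Suc i)) \<oplus> ((\<Oplus>i\<in>{..n}. ?v (Suc i)) \<oplus> ?v 0)"
    using a b by (subst split0) auto
  also have "\<dots> = (\<Oplus>i\<in>{..n}. ?u (Suc i) \<oplus> ?v (Suc i)) \<oplus> ?v 0"
    using a b by (subst finsum_addf) (auto simp: a_assoc)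
  also have "(\<Oplus>i\<in>{..n}. ?u (Suc i) \<oplus> ?v (Suc i)) = (\<Oplus>i\<in>{..n}. ?t (Suc n) (Suc i))"
    using a b by (intro finsum_cong') (auto simp: add.nat_pow_mult)
  also have "\<dots> \<oplus> ?v 0 = (\<Oplus>i\<in>{..Suc n}. ?t (Suc n) i)"
    using a b by (subst split0) auto
  finally show ?case .
qed

lemma (in cring) add_pow_eq_zero_of_dvd:
  assumes "[p] \<cdot> \<one> = \<zero>" "p dvd (m::nat)" "x \<in> carrier R"
  shows "[m] \<cdot> x = \<zero>"
proof -
  obtain c where "m = p * c" using assms(2) by auto
  then have "[m] \<cdot> \<one> = \<zero>" using assms(1) by (metis add.nat_pow_pow add.nat_pow_one one_closed)
  then show ?thesis using add_pow_ldistr[of \<one> x m] assms(3) by simp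
qed

text \<open>
  Of the binomial expansion of a \<open>p\<close>-th power only the two end terms remain, as \<open>p\<close> divides all
  inner binomial coefficients; iteration gives the powers of \<open>p\<close>.
\<close>

lemma (in cring) frobenius_add:
  assumes p: "Factorial_Ring.prime (p::nat)" and char: "[p] \<cdot> \<one> = \<zero>"
    and a: "a \<in> carrier R" and b: "b \<in> carrier R"
  shows "(a \<oplus> b) [^] (p ^ n) = a [^] (p ^ n) \<oplus> b [^] (p ^ n)"
proof (induction n)
  case 0
  then show ?case using a b by simp
next
  case (Suc n)
  have one: "(u \<oplus> v) [^] p = u [^] p \<oplus> v [^] p" if u: "u \<in> carrier R" and v: "v \<in> carrier R" for u v
  proof -
    let ?t = "\<lambda>i. [(p choose i)] \<cdot> (u [^] i \<otimes> v [^] (p - i))"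
    have "p > 0" using p by (simp add: prime_gt_0_nat)
    have "?t i = \<zero>" if "i \<noteq> 0" "i \<noteq> p" "i \<le> p" for i
      using that u v p by (intro add_pow_eq_zero_of_dvd[OF char] dvd_choose_prime) auto
    then have "(\<Oplus>i\<in>{..p}. ?t i) = (\<Oplus>i\<in>{0, p}. ?t i)"
      using u v by (intro add.finprod_mono_neutral_cong_right) auto
    also have "\<dots> = u [^] p \<oplus> v [^] p"
      using \<open>p > 0\<close> u v by (simp add: a_comm)
    finally show ?thesis using binomial_theorem[OF u v, of p] by simp
  qed
  have pw: "x [^] (p ^ Suc n) = (x [^] (p ^ n)) [^] p" if "x \<in> carrier R" for x
    using that by (simp add: nat_pow_pow mult.commute)
  show ?case using a b Suc by (simp add: pw one del: power_Suc)
qed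

lemma (in ring_hom_ring) hom_add_pow:
  assumes "a \<in> carrier R"
  shows "h ([(n::nat)] \<cdot>\<^bsub>R\<^esub> a) = [n] \<cdot>\<^bsub>S\<^esub> h a"
  using assms by (induction n) auto

lemma (in cring) frobenius_a_inv:
  assumes p: "Factorial_Ring.prime (p::nat)" and char: "[p] \<cdot> \<one> = \<zero>" and a: "a \<in> carrier R"
  shows "(\<ominus> a) [^] (p ^ n) = \<ominus> (a [^] (p ^ n))"
proof -
  have "p ^ n > 0" using p by (simp add: prime_gt_0_nat)
  have "(\<ominus> a) [^] (p ^ n) \<oplus> a [^] (p ^ n) = (\<ominus> a \<oplus> a) [^] (p ^ n)"
    using a by (simp only: frobenius_add[OF p char] a_inv_closed)
  also have "\<dots> = \<zero>" using a \<open>p ^ n > 0\<close> by (simp add: l_neg nat_pow_zero)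
  finally show ?thesis using a by (intro minus_equality[symmetric]) auto
qed

section \<open>Finite fields of prime power order\<close>

lemma (in field) subfield_frobenius_fixed_points:
  assumes p: "Factorial_Ring.prime (p::nat)" and char: "[p] \<cdot> \<one> = \<zero>"
  shows "subfield {a \<in> carrier R. a [^] (p ^ n) = a} R" (is "subfield ?K R")
proof (rule subfieldI')
  show "subring ?K R"
    using frobenius_add[OF p char] frobenius_a_inv[OF p char]
    by (intro subringI) (auto simp: nat_pow_distrib)
next
  fix a assume a: "a \<in> ?K - {\<zero>}"
  then have u: "a \<in> Units R" by (simp add: field_Units)
  then have ia: "inv a \<in> carrier R" by simp
  have "a \<otimes> (inv a) [^] (p ^ n) = (a \<otimes> inv a) [^] (p ^ n)"
    using a ia by (simp add: nat_pow_distrib)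
  then have "(inv a) [^] (p ^ n) = inv a"
    using a u ia by (intro comm_inv_char[symmetric]) auto
  then show "inv a \<in> ?K" using a u by auto
qed

text \<open>
  The fixed points are the roots of \<open>P = X\<^sup>Q - X\<close> with \<open>Q = p\<^sup>n\<close>. Since \<open>P\<close> splits, it has \<open>Q\<close> roots
  with multiplicity, so it suffices that every root \<open>a\<close> is simple. For this, the Frobenius
  identity in the polynomial ring replaces the usual derivative argument: with \<open>T = X - a\<close> and
  \<open>a\<^sup>Q = a\<close> it gives \<open>P = T\<^sup>Q - T\<close>, so that \<open>T\<^sup>2\<close> dividing \<open>P\<close> would divide \<open>T\<close>.
\<close>

lemma (in field) card_frobenius_fixed_points:
  assumes p: "Factorial_Ring.prime (p::nat)" and char: "[p] \<cdot> \<one> = \<zero>" and "n > 0"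
    and split: "splitted (X [^]\<^bsub>poly_ring R\<^esub> (p ^ n) \<ominus>\<^bsub>poly_ring R\<^esub> X)"
  shows "card {a \<in> carrier R. a [^] (p ^ n) = a} = p ^ n"
proof -
  interpret UP: domain "poly_ring R"
    using univ_poly_is_domain[OF carrier_is_subring] .
  let ?q = "p ^ n"
  have q: "?q \<ge> 2"
    using p \<open>n > 0\<close> by (metis One_nat_def Suc_leI one_less_power prime_gt_1_nat numeral_2_eq_2)
  define P where "P = X [^]\<^bsub>poly_ring R\<^esub> ?q \<ominus>\<^bsub>poly_ring R\<^esub> X"
  have X: "X \<in> carrier (poly_ring R)" using var_closed[OF carrier_is_subring] by simp
  have Xq: "X [^]\<^bsub>poly_ring R\<^esub> ?q \<in> carrier (poly_ring R)" using X by simp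
  have P: "P \<in> carrier (poly_ring R)" using X by (simp add: P_def)
  have dX: "degree X = 1" by (simp add: var_def)
  have degP: "degree P = ?q"
  proof -
    have m: "\<ominus>\<^bsub>poly_ring R\<^esub> X = map (\<lambda>a. \<ominus> a) X"
      using univ_poly_a_inv_def'[OF carrier_is_subring X] .
    have dm: "degree (\<ominus>\<^bsub>poly_ring R\<^esub> X) = 1" unfolding m by (simp add: var_def)
    have dXq: "degree (X [^]\<^bsub>poly_ring R\<^esub> ?q) = ?q"
      using polynomial_pow_degree[OF X] dX by simp
    have "degree (poly_add (X [^]\<^bsub>poly_ring R\<^esub> ?q) (\<ominus>\<^bsub>poly_ring R\<^esub> X))
        = max (degree (X [^]\<^bsub>poly_ring R\<^esub> ?q)) (degree (\<ominus>\<^bsub>poly_ring R\<^esub> X))"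
    proof (rule poly_add_degree_eq[OF carrier_is_subring])
      show "polynomial (carrier R) (X [^]\<^bsub>poly_ring R\<^esub> ?q)" "polynomial (carrier R) (\<ominus>\<^bsub>poly_ring R\<^esub> X)"
        using Xq X by (simp_all add: univ_poly_carrier)
      show "degree (X [^]\<^bsub>poly_ring R\<^esub> ?q) \<noteq> degree (\<ominus>\<^bsub>poly_ring R\<^esub> X)"
        using dXq dm q by linarith
    qed
    then show ?thesis
      using q unfolding dXq dm P_def a_minus_def univ_poly_add by linarith
  qed
  have "P \<noteq> []"
  proof
    assume "P = []"
    then have "degree P = 0" by simp
    then show False using degP q by linarith
  qed
  have evalP: "eval P a = a [^] ?q \<ominus> a" if a: "a \<in> carrier R" for a
  proof -
    interpret ev: ring_hom_cring "poly_ring R" R "\<lambda>f. eval f a"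
      using eval_cring_hom[OF carrier_is_subring] a by simp
    show ?thesis
      unfolding P_def using X a by (simp add: a_minus_def eval_var)
  qed
  have root: "is_root P a \<longleftrightarrow> a \<in> carrier R \<and> a [^] ?q = a" for a
    using evalP \<open>P \<noteq> []\<close> by (auto simp: is_root_def)
  have simple: "alg_mult P a \<le> 1" if "is_root P a" for a
  proof (rule ccontr)
    assume "\<not> alg_mult P a \<le> 1"
    then have two: "2 \<le> alg_mult P a" by simp
    have a: "a \<in> carrier R" "a [^] ?q = a" using that root by auto
    define T c where "T = [\<one>, \<ominus> a]" and "c = poly_of_const a"
    have T: "T \<in> carrier (poly_ring R)"
      using a by (auto simp: T_def polynomial_def sym[OF univ_poly_carrier])
    interpret cn: ring_hom_ring R "poly_ring R" poly_of_const
      using canonical_embedding_ring_hom[OF carrier_is_subring] by simp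
    have c: "c \<in> carrier (poly_ring R)" and cq: "c [^]\<^bsub>poly_ring R\<^esub> ?q = c"
      using a unfolding c_def by (simp_all add: cn.hom_nat_pow[symmetric])
    have charU: "[p] \<cdot>\<^bsub>poly_ring R\<^esub> \<one>\<^bsub>poly_ring R\<^esub> = \<zero>\<^bsub>poly_ring R\<^esub>"
      using cn.hom_add_pow[of \<one> p] char by simp
    have XT: "X = T \<oplus>\<^bsub>poly_ring R\<^esub> c"
      using a by (auto simp: T_def c_def var_def univ_poly_add poly_of_const_def l_neg)
    have "P = (T [^]\<^bsub>poly_ring R\<^esub> ?q \<oplus>\<^bsub>poly_ring R\<^esub> c) \<ominus>\<^bsub>poly_ring R\<^esub> (T \<oplus>\<^bsub>poly_ring R\<^esub> c)"
      unfolding P_def XT using UP.frobenius_add[OF p charU T c] cq by simp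
    also have "\<dots> = T [^]\<^bsub>poly_ring R\<^esub> ?q \<ominus>\<^bsub>poly_ring R\<^esub> T"
      using T c by (simp add: a_minus_def UP.minus_add UP.a_ac UP.r_neg UP.r_neg1 UP.r_neg2)
    finally have PT: "P = T [^]\<^bsub>poly_ring R\<^esub> ?q \<ominus>\<^bsub>poly_ring R\<^esub> T" .
    let ?T2 = "T [^]\<^bsub>poly_ring R\<^esub> (2::nat)"
    have T2: "?T2 \<in> carrier (poly_ring R)" using T by simp
    have "?T2 pdivides P"
      using le_alg_mult_imp_pdivides[OF a(1) P two] unfolding T_def .
    then obtain g where g: "g \<in> carrier (poly_ring R)" "P = ?T2 \<otimes>\<^bsub>poly_ring R\<^esub> g"
      unfolding pdivides_def by auto
    have Tq: "T [^]\<^bsub>poly_ring R\<^esub> ?q = ?T2 \<otimes>\<^bsub>poly_ring R\<^esub> T [^]\<^bsub>poly_ring R\<^esub> (?q - 2)"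
      using UP.nat_pow_mult[OF T, of 2 "?q - 2"] le_add_diff_inverse[OF q] by metis
    have "T = T [^]\<^bsub>poly_ring R\<^esub> ?q \<ominus>\<^bsub>poly_ring R\<^esub> P"
      unfolding PT using T by (simp add: a_minus_def UP.minus_add UP.a_ac UP.r_neg UP.r_neg1 UP.r_neg2)
    also have "\<dots> = ?T2 \<otimes>\<^bsub>poly_ring R\<^esub> (T [^]\<^bsub>poly_ring R\<^esub> (?q - 2) \<ominus>\<^bsub>poly_ring R\<^esub> g)"
      unfolding Tq g(2) using T T2 g(1) by (simp add: a_minus_def UP.r_distr UP.r_minus)
    finally have "?T2 pdivides T"
      unfolding pdivides_def using T T2 g(1) by (intro dividesI) auto
    then have "degree ?T2 \<le> degree T"
      using pdivides_imp_degree_le[OF carrier_is_subring T2 T] by (simp add: T_def)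
    then show False using polynomial_pow_degree[OF T, of 2] by (simp add: T_def)
  qed
  have cnt: "count (roots P) = alg_mult P" using alg_mult_eq_count_roots[OF P] by simp
  have set: "set_mset (roots P) = {a \<in> carrier R. a [^] ?q = a}"
    using roots_mem_iff_is_root[OF P] root by auto
  have "roots P = mset_set (set_mset (roots P))"
  proof (rule multiset_eqI)
    fix a show "count (roots P) a = count (mset_set (set_mset (roots P))) a"
      using simple[of a] roots_mem_iff_is_root[OF P, of a] alg_mult_gt_zero_iff_is_root[OF P, of a] cnt
      by (cases "a \<in># roots P") (auto simp: le_Suc_eq not_in_iff count_eq_zero_iff)
  qed
  then have "size (roots P) = card (set_mset (roots P))"
    by (metis size_mset_set)
  moreover have "size (roots P) = ?q" using split degP unfolding splitted_def P_def by simp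
  ultimately show ?thesis unfolding set by simp
qed

text \<open>
  The closure provides a splitting of \<open>X\<^sup>Q - X\<close> because this polynomial has its coefficients in the
  prime field.
\<close>

lemma primepow_obtains_finite_subfield:
  assumes "primepow (p::nat)"
  obtains L :: "((int list \<times> nat) multiset \<Rightarrow> int) ring" and K
  where "field L" "subfield K L" "card K = p"
proof -
  obtain q n where q: "Factorial_Ring.prime q" "n > 0" "p = q ^ n"
    using assms by (auto simp: primepow_def)
  let ?R = "residue_ring (int q)"
  interpret R: residues_prime q ?R using q(1) by unfold_locales auto
  obtain L :: "((int list \<times> nat) multiset \<Rightarrow> int) ring"
    where L: "algebraic_closure L (R.indexed_const ` carrier ?R)" and hom: "R.indexed_const \<in> ring_hom ?R L"
    using R.exists_closure by (rule R.exists_closure)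
  interpret L: algebraic_closure L "R.indexed_const ` carrier ?R" using L .
  interpret h: ring_hom_ring ?R L "R.indexed_const"
    using hom by (intro ring_hom_ringI2 R.ring_axioms L.ring_axioms)
  have charR: "[q] \<cdot>\<^bsub>?R\<^esub> \<one>\<^bsub>?R\<^esub> = \<zero>\<^bsub>?R\<^esub>"
  proof -
    have "[m] \<cdot>\<^bsub>?R\<^esub> \<one>\<^bsub>?R\<^esub> = int m mod int q" for m :: nat
      by (induction m) (simp_all add: R.res_add_eq R.res_one_eq R.res_zero_eq mod_simps add.commute)
    then show ?thesis by (simp add: R.res_zero_eq)
  qed
  have charL: "[q] \<cdot>\<^bsub>L\<^esub> \<one>\<^bsub>L\<^esub> = \<zero>\<^bsub>L\<^esub>"
    using h.hom_add_pow[of "\<one>\<^bsub>?R\<^esub>" q] charR by simp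
  let ?F = "R.indexed_const ` carrier ?R" and ?U = "poly_ring L"
  have F: "subring ?F L" using L.subfield_axioms by (simp add: subfieldE(1))
  interpret FX: domain "(univ_poly L ?F)" using L.univ_poly_is_domain[OF F] .
  have X: "var L \<in> carrier (univ_poly L ?F)" by (rule L.var_closed(1)[OF F])
  (* Membership in the polynomial ring over the prime field; the operations of the two
     polynomial rings agree, but they are different terms. *)
  have "var L [^]\<^bsub>?U\<^esub> p \<ominus>\<^bsub>?U\<^esub> var L = var L [^]\<^bsub>univ_poly L ?F\<^esub> p \<ominus>\<^bsub>univ_poly L ?F\<^esub> var L"
    using L.univ_poly_a_minus_consistent[OF F X] L.unitary_monom_eq_var_pow[OF F]
      L.unitary_monom_eq_var_pow[OF L.carrier_is_subring] by metis
  also have "\<dots> \<in> carrier (univ_poly L ?F)" using X by simp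
  finally have "L.splitted (var L [^]\<^bsub>?U\<^esub> p \<ominus>\<^bsub>?U\<^esub> var L)"
    by (rule L.roots_over_subfield)
  then have "card {a \<in> carrier L. a [^]\<^bsub>L\<^esub> p = a} = p"
    using L.card_frobenius_fixed_points[OF q(1) charL q(2)] q(3) by simp
  moreover have "subfield {a \<in> carrier L. a [^]\<^bsub>L\<^esub> p = a} L"
    using L.subfield_frobenius_fixed_points[OF q(1) charL, of n] q(3) by simp
  ultimately show thesis by (intro that[OF L.field_axioms])
qed

section \<open>The lower bound\<close>

lemma (in abelian_group) diff_eq_imp_cross_eq:
  assumes c: "u \<in> carrier G" "v \<in> carrier G" "y \<in> carrier G" "y' \<in> carrier G"
    and eq: "u \<ominus> v = y \<ominus> y'"
  shows "y \<ominus> u = y' \<ominus> v"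
proof -
  have "y = (y \<ominus> y') \<oplus> y'" using c by (simp add: a_minus_def a_assoc l_neg)
  also have "\<dots> = u \<oplus> (y' \<ominus> v)" unfolding eq[symmetric] using c by (simp add: a_minus_def a_ac)
  finally have "y \<ominus> u = u \<oplus> (y' \<ominus> v) \<ominus> u" by simp
  also have "\<dots> = y' \<ominus> v"
    using c a_comm[of u "y' \<ominus> v"] by (simp add: minus_eq[of _ u] a_assoc r_neg)
  finally show ?thesis .
qed

theorem theorem3p11:
  fixes k p :: nat
  assumes "k > 0" and "primepow p" and "p \<le> k"
  shows "max_semiintersecting k (p * k) \<ge> p ^ 2"
proof -
  obtain L :: "((int list \<times> nat) multiset \<Rightarrow> int) ring" and K
    where L: "field L" and K: "subfield K L" and card: "card K = p"
    using primepow_obtains_finite_subfield[OF assms(2)] by blast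
  interpret field L by (fact L)
  have KL: "x \<in> carrier L" if "x \<in> K" for x
    using that subfieldE(3)[OF K] by auto
  have sub: "subring K L" using subfieldE(1)[OF K] .
  have diff: "x \<ominus>\<^bsub>L\<^esub> y \<in> K" if "x \<in> K" "y \<in> K" for x y
    using that subringE(5,7)[OF sub] by (simp add: a_minus_def)
  have "p > 0" using assms(2) by (simp add: primepow_gt_0_nat)
  (* The intercept of the line with slope m through the point (x, y). *)
  define h where "h m x y = y \<ominus>\<^bsub>L\<^esub> m \<otimes>\<^bsub>L\<^esub> x" for m x y
  have "(card K)\<^sup>2 \<le> max_semiintersecting k (card K * k)"
  proof (rule max_semiintersecting_ge_of_planar_coordinates[where h = h])
    show "finite K" "K \<noteq> {}" using card \<open>p > 0\<close> by (auto intro: card_ge_0_finite)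
    show "card K \<le> k" using card assms(3) by simp
    show "h m x y \<in> K" if "m \<in> K" "x \<in> K" "y \<in> K" for m x y
      unfolding h_def using that diff subringE(6)[OF sub] by blast
    show "y = y'" if "m \<in> K" "x \<in> K" "y \<in> K" "y' \<in> K" "h m x y = h m x y'" for m x y y'
      using that KL by (auto simp: h_def a_minus_def)
    show "\<exists>m\<in>K. h m x y = h m x' y'"
      if K4: "x \<in> K" "x' \<in> K" "y \<in> K" "y' \<in> K" and "x \<noteq> x'" for x x' y y'
    proof
      note c = K4[THEN KL]
      have "x \<ominus>\<^bsub>L\<^esub> x' \<noteq> \<zero>\<^bsub>L\<^esub>" using c \<open>x \<noteq> x'\<close> by simp
      then have inv: "inv\<^bsub>L\<^esub> (x \<ominus>\<^bsub>L\<^esub> x') \<in> K" "inv\<^bsub>L\<^esub> (x \<ominus>\<^bsub>L\<^esub> x') \<otimes>\<^bsub>L\<^esub> (x \<ominus>\<^bsub>L\<^esub> x') = \<one>\<^bsub>L\<^esub>"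
        using subfield_m_inv[OF K, of "x \<ominus>\<^bsub>L\<^esub> x'"] diff K4 by auto
      (* The slope of the line joining the two points. *)
      define m where "m = (y \<ominus>\<^bsub>L\<^esub> y') \<otimes>\<^bsub>L\<^esub> inv\<^bsub>L\<^esub> (x \<ominus>\<^bsub>L\<^esub> x')"
      show mK: "m \<in> K" unfolding m_def using K4 diff inv subringE(6)[OF sub] by blast
      have "m \<otimes>\<^bsub>L\<^esub> (x \<ominus>\<^bsub>L\<^esub> x') = y \<ominus>\<^bsub>L\<^esub> y'"
        unfolding m_def using c inv KL by (simp add: m_assoc)
      then have "m \<otimes>\<^bsub>L\<^esub> x \<ominus>\<^bsub>L\<^esub> m \<otimes>\<^bsub>L\<^esub> x' = y \<ominus>\<^bsub>L\<^esub> y'"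
        using c KL[OF mK] by (simp add: a_minus_def r_distr r_minus)
      then show "h m x y = h m x' y'"
        using c KL[OF mK] diff_eq_imp_cross_eq[of "m \<otimes>\<^bsub>L\<^esub> x" "m \<otimes>\<^bsub>L\<^esub> x'" y y']
        unfolding h_def by simp
    qed
  qed
  then show ?thesis using card by simp
qed

end
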